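(* Let $n\ge 2$ and $k\ge 0$ be integers and let $$\mu_n(k):=L_n\cdot\left[\overline{2(5k+3),\,1^{(n-2)},\,2,\,1,\,2k,\,1,\,2,\,1^{(n-2)}}\right].$$ Then $\mu_n(k)$ is an algebraic integer. Moreover, if $n$ is odd, then $$\mu_n(k)=\left[\tilde L_{n+1}(10k+6)-1,\ \overline{1,\ \tfrac{2}{5}\tilde L_{n+1}(5k+3)-2,\ 1,\ 2\tilde L_{n+1}(5k+3)-2}\right],$$ and if $n$ is even, then $$\mu_n(k)=\left[\tilde L_{n+1}(10k+6),\ \overline{\tfrac{2}{5}\tilde L_{n+1}(5k+3),\ 2\tilde L_{n+1}(5k+3)}\right].$$
   Context: $L_n$ denotes the Lucas numbers: $L_0=2$, $L_1=1$, $L_{n+1}=L_n+L_{n-1}$. For a positive integer $m$, the Lucas-like numbers are $\tilde L_n(m)=mL_{n-1}+L_{n-2}$ (so $\tilde L_{n+1}(m)=mL_n+L_{n-1}$). The notation $[a_0,a_1,a_2,\dots]$ denotes the continued fraction $a_0+\cfrac{1}{a_1+\cfrac{1}{a_2+\cdots}}$, its value being the limit of its convergents $p_j/q_j$, where $p_j=a_jp_{j-1}+p_{j-2}$, $q_j=a_jq_{j-1}+q_{j-2}$, $p_{-1}=1$, $p_0=a_0$, $q_{-1}=0$, $q_0=1$; when $k=0$ the entry $2k$ equals $0$ and the expansion is understood in this sense (so that $[\dots,a,0,b,\dots]=[\dots,a+b,\dots]$). An overline denotes a block repeated indefinitely: $[a_0,\dots,a_r,\overline{b_1,\dots,b_s}]$,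 or $[\overline{b_1,\dots,b_s}]$ in the purely periodic case. $1^{(j)}$ denotes the string $1,1,\dots,1$ of $j$ ones (empty if $j=0$). *)

theory Defs
  imports Complex_Main "HOL-Computational_Algebra.Polynomial"
begin

fun lucas :: "nat \<Rightarrow> int" where
  "lucas 0 = 2"
| "lucas (Suc 0) = 1"
| "lucas (Suc (Suc n)) = lucas (Suc n) + lucas n"

(* The subtractions on nat are truncated: intended for n \<ge> 2. *)
definition lucas_like :: "nat \<Rightarrow> int \<Rightarrow> int" where
  "lucas_like n m = m * lucas (n - 1) + lucas (n - 2)"

(* Numerators p_j and denominators q_j (j \<ge> 0) of the convergents of [a_0, a_1, ...].
   The initial values p_{-1} = 1 and q_{-1} = 0 are absorbed into the equations for j = 1. *)
fun cf_num :: "(nat \<Rightarrow> int) \<Rightarrow> nat \<Rightarrow> int" where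
  "cf_num a 0 = a 0"
| "cf_num a (Suc 0) = a 1 * a 0 + 1"
| "cf_num a (Suc (Suc j)) = a (Suc (Suc j)) * cf_num a (Suc j) + cf_num a j"

fun cf_den :: "(nat \<Rightarrow> int) \<Rightarrow> nat \<Rightarrow> int" where
  "cf_den a 0 = 1"
| "cf_den a (Suc 0) = a 1"
| "cf_den a (Suc (Suc j)) = a (Suc (Suc j)) * cf_den a (Suc j) + cf_den a j"

definition cf_convergent :: "(nat \<Rightarrow> int) \<Rightarrow> nat \<Rightarrow> real" where
  "cf_convergent a j = of_int (cf_num a j) / of_int (cf_den a j)"

definition has_cf_value :: "(nat \<Rightarrow> int) \<Rightarrow> real \<Rightarrow> bool" where
  "has_cf_value a x \<longleftrightarrow> cf_convergent a \<longlonglongrightarrow> x"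

(* Unspecified if the convergents do not converge. *)
definition cf_value :: "(nat \<Rightarrow> int) \<Rightarrow> real" where
  "cf_value a = lim (cf_convergent a)"

(* The entries of [xs, ys, ys, ys, ...], for a nonempty block ys. *)
definition cf_periodic :: "int list \<Rightarrow> int list \<Rightarrow> nat \<Rightarrow> int" where
  "cf_periodic xs ys i =
     (if i < length xs then xs ! i else ys ! ((i - length xs) mod length ys))"

definition mu_block :: "nat \<Rightarrow> nat \<Rightarrow> int list" where
  "mu_block n k =
     [2 * (5 * int k + 3)] @ replicate (n - 2) 1 @ [2, 1, 2 * int k, 1, 2] @ replicate (n - 2) 1"

definition mu :: "nat \<Rightarrow> nat \<Rightarrow> real" where
  "mu n k = of_int (lucas n) * cf_value (cf_periodic [] (mu_block n k))"

end

theory Submission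
  imports Defs "HOL-Number_Theory.Fib"
begin

(* Put x = [block], m = 5k + 3, L = L_n and N = m L_n + L_{n-1}. The entries of the block after the
   first form a palindrome, so their matrix is symmetric and the fixed point equation of x has the
   form P x^2 - 2 m P x = 2 m Q + R. Writing n = j + 2 and expressing everything through f_j and
   f_{j+1}, it reduces to L (x^2 - 2 m x) = 2 m L_{n-1} + L_{n-2}, and Cassini's identity for the
   Lucas numbers turns this into (L x - m L)^2 = N^2 + 5 (-1)^n. Hence mu = m L + sqrt (N^2 +- 5) is
   an algebraic integer, and the expansions of sqrt (N^2 +- 5) in terms of N are classical. *)

section \<open>Convergence from complete quotients\<close>

text \<open>Zero entries do no harm: q_{j+2} >= q_j, and both q_0 = 1 and q_1 = \<open>a 1\<close>
  are at least 1.\<close>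

lemma cf_den_pos:
  assumes "\<And>i. i \<ge> 1 \<Longrightarrow> a i \<ge> 0" "a 1 \<ge> 1"
  shows "cf_den a j \<ge> 1"
proof (induction j rule: induct_nat_012)
  case (ge2 j)
  have "a (Suc (Suc j)) * cf_den a (Suc j) \<ge> 0"
    using ge2 assms(1)[of "Suc (Suc j)"] by simp
  then show ?case using ge2 by simp
qed (use assms in auto)

lemma cf_determinant:
  "cf_num a (Suc j) * cf_den a j - cf_num a j * cf_den a (Suc j) = (-1) ^ j"
  by (induction j) (auto simp: algebra_simps)

text \<open>The \<open>X i\<close> are the complete quotients, so this is x = (p_{j+1} Y + p_j) /
  (q_{j+1} Y + q_j) with Y = \<open>X (j + 2)\<close>, cleared of denominators. Substituting Y =
  a_{j+2} + 1 / Y' carries it from j to j + 1.\<close>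

lemma cf_complete_quotient:
  fixes X :: "nat \<Rightarrow> real"
  assumes X: "\<And>i. X i = of_int (a i) + 1 / X (Suc i)" and nz: "\<And>i. X (Suc i) \<noteq> 0"
  shows "X 0 * (of_int (cf_den a (Suc j)) * X (Suc (Suc j)) + of_int (cf_den a j))
       = of_int (cf_num a (Suc j)) * X (Suc (Suc j)) + of_int (cf_num a j)"
proof (induction j)
  case 0
  have "X 0 * X 1 = of_int (a 0) * X 1 + 1"
    using X[of 0] nz[of 0] by (simp add: field_simps)
  moreover have "X 1 * X 2 = of_int (a 1) * X 2 + 1"
    using X[of 1] nz[of 1] by (simp add: field_simps numeral_2_eq_2)
  ultimately have "X 0 * (of_int (a 1) * X 2 + 1) = of_int (a 0) * (of_int (a 1) * X 2 + 1) + X 2"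
    by algebra
  then show ?case by (simp add: algebra_simps numeral_2_eq_2)
next
  case (Suc j)
  have "X (j + 2) * X (j + 3) = of_int (a (j + 2)) * X (j + 3) + 1"
    using X[of "j + 2"] nz[of "j + 2"] by (simp add: field_simps eval_nat_numeral)
  moreover have "X 0 * (of_int (cf_den a (Suc j)) * X (j + 2) + of_int (cf_den a j))
       = of_int (cf_num a (Suc j)) * X (j + 2) + of_int (cf_num a j)"
    using Suc by simp
  ultimately have "X 0 * ((of_int (a (j + 2)) * of_int (cf_den a (Suc j)) + of_int (cf_den a j)) * X (j + 3)
         + of_int (cf_den a (Suc j)))
       = (of_int (a (j + 2)) * of_int (cf_num a (Suc j)) + of_int (cf_num a j)) * X (j + 3)
         + of_int (cf_num a (Suc j))"
    by algebra
  then show ?case by (simp add: eval_nat_numeral)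
qed

(* Zero entries are allowed, so the q_j need not increase. The products q_j q_{j+1} do:
   they grow by at least a_{j+2} in each step. *)
lemma cf_den_prod_unbounded:
  assumes nonneg: "\<And>i. i \<ge> 1 \<Longrightarrow> a i \<ge> 0" and a1: "a 1 \<ge> 1"
    and inf: "\<And>j. \<exists>i\<ge>j. a i > 0"
  shows "filterlim (\<lambda>j. real_of_int (cf_den a (Suc j) * cf_den a j)) at_top sequentially"
proof -
  define D where "D j = cf_den a (Suc j) * cf_den a j" for j
  note den = cf_den_pos[of a, OF nonneg a1]
  have step: "D (Suc j) \<ge> D j + a (Suc (Suc j))" for j
  proof -
    \<comment> \<open>Because q_{j+2} q_{j+1} = a_{j+2} q_{j+1}^2 + q_{j+1} q_j, the bound q_{j+1}
      >= 1 suffices.\<close>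
    have "cf_den a (Suc j) * cf_den a (Suc j) \<ge> 1 * 1"
      using den[of "Suc j"] by (intro mult_mono) auto
    then have "a (Suc (Suc j)) * (cf_den a (Suc j) * cf_den a (Suc j)) \<ge> a (Suc (Suc j)) * 1"
      using nonneg[of "Suc (Suc j)"] by (intro mult_left_mono) auto
    then show ?thesis by (simp add: D_def algebra_simps)
  qed
  have mono: "incseq D"
  proof (rule incseq_SucI)
    fix j show "D j \<le> D (Suc j)" using step[of j] nonneg[of "Suc (Suc j)"] by simp
  qed
  have large: "\<exists>j. D j \<ge> int N" for N
  proof (induction N)
    case 0
    have "D 0 \<ge> 0" using den[of 0] den[of 1] by (simp add: D_def)
    then show ?case by auto
  next
    case (Suc N)
    then obtain j where j: "D j \<ge> int N" by blast
    obtain i where i: "i \<ge> j + 2" "a i > 0" using inf by blast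
    define i' where "i' = i - 2"
    have "i = Suc (Suc i')" "i' \<ge> j" using i by (auto simp: i'_def)
    then have "D (Suc i') \<ge> D j + 1"
      using step[of i'] i monoD[OF mono, of j i'] by simp
    then show ?case using j by (intro exI[of _ "Suc i'"]) simp
  qed
  have "filterlim (\<lambda>j. real_of_int (D j)) at_top sequentially"
    unfolding filterlim_at_top
  proof
    fix Z :: real
    obtain j where j: "D j \<ge> int (nat \<lceil>Z\<rceil>)" using large by blast
    have "Z \<le> real_of_int (D i)" if "i \<ge> j" for i
      using j monoD[OF mono that] by linarith
    then show "\<forall>\<^sub>F i in sequentially. Z \<le> real_of_int (D i)"
      by (auto simp: eventually_sequentially)
  qed
  then show ?thesis by (simp add: D_def)
qed

text \<open>The error of p_{j+1} / q_{j+1} is exactly 1 / (q_{j+1} (q_{j+1} Y + q_j)) in absolute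
  value, with a complete quotient Y > 0. Hence it is at most 1 / (q_{j+1} q_j), which tends to
  0.\<close>

lemma has_cf_value_complete_quotients:
  fixes X :: "nat \<Rightarrow> real"
  assumes X: "\<And>i. X i = of_int (a i) + 1 / X (Suc i)" and pos: "\<And>i. X (Suc i) > 0"
    and nonneg: "\<And>i. i \<ge> 1 \<Longrightarrow> a i \<ge> 0" and a1: "a 1 \<ge> 1"
    and inf: "\<And>j. \<exists>i\<ge>j. a i > 0"
  shows "has_cf_value a (X 0)"
proof -
  note den = cf_den_pos[of a, OF nonneg a1]
  define B where "B j = inverse (real_of_int (cf_den a (Suc j) * cf_den a j))" for j
  have "B \<longlonglongrightarrow> 0"
    unfolding B_def
    by (intro tendsto_inverse_0_at_top cf_den_prod_unbounded nonneg a1 inf)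
  moreover have "norm (cf_convergent a (Suc j) - X 0) \<le> B j" for j
  proof -
    define p q p' q' Y where "p = real_of_int (cf_num a j)" "q = real_of_int (cf_den a j)"
      "p' = real_of_int (cf_num a (Suc j))" "q' = real_of_int (cf_den a (Suc j))"
      "Y = X (Suc (Suc j))"
    note defs = this
    have q: "q \<ge> 1" "q' \<ge> 1" using den[of j] den[of "Suc j"] by (simp_all add: defs)
    have Y: "Y > 0" using pos by (simp add: defs)
    have "X 0 * (q' * Y + q) = p' * Y + p"
      unfolding defs by (rule cf_complete_quotient[of X, OF X less_imp_neq[OF pos, symmetric]])
    \<comment> \<open>The terms in \<open>Y\<close> cancel and leave the determinant of two
      consecutive convergents.\<close>
    then have "(p' - X 0 * q') * (q' * Y + q) = p' * q - p * q'" by algebra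
    also have "\<dots> = (-1) ^ j"
      using arg_cong[OF cf_determinant[of a j], of real_of_int] by (simp add: defs)
    finally have "(p' - X 0 * q') * (q' * Y + q) = (-1) ^ j" .
    moreover have "(p' / q' - X 0) * q' = p' - X 0 * q'"
      using q by (simp add: field_simps)
    ultimately have "(p' / q' - X 0) * (q' * (q' * Y + q)) = (-1) ^ j"
      by (metis mult.assoc)
    then have "\<bar>p' / q' - X 0\<bar> * \<bar>q' * (q' * Y + q)\<bar> = 1"
      by (metis abs_mult power_abs abs_neg_one power_one)
    then have "\<bar>p' / q' - X 0\<bar> * (q' * (q' * Y + q)) = 1"
      using q Y by simp
    moreover have "q' * q \<le> q' * (q' * Y + q)" "q' * q > 0"
      using q Y by auto
    ultimately have "\<bar>p' / q' - X 0\<bar> * (q' * q) \<le> 1"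
      by (metis abs_ge_zero mult_left_mono)
    then have "\<bar>p' / q' - X 0\<bar> \<le> inverse (q' * q)"
      using \<open>q' * q > 0\<close> by (simp add: field_simps)
    then show ?thesis by (simp add: defs B_def cf_convergent_def)
  qed
  ultimately have "(\<lambda>j. cf_convergent a (Suc j) - X 0) \<longlonglongrightarrow> 0"
    by (elim tendsto_0_le[where K = 1]) (auto intro!: always_eventually intro: order_trans[OF _ abs_ge_self])
  then show ?thesis
    unfolding has_cf_value_def by (simp add: LIM_zero_iff filterlim_sequentially_Suc)
qed

section \<open>Periodic continued fractions\<close>

text \<open>The finite continued fraction [a_0, ..., a_r, x] closed by a real number x. The value of
  a purely periodic expansion is a fixed point of \<open>cf_tail ys\<close>, where \<open>ys\<close>
  is the period.\<close>

fun cf_tail :: "int list \<Rightarrow> real \<Rightarrow> real" where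
  "cf_tail [] x = x"
| "cf_tail (a # as) x = of_int a + 1 / cf_tail as x"

lemma cf_tail_append: "cf_tail (xs @ ys) x = cf_tail xs (cf_tail ys x)"
  by (induction xs) auto

lemma cf_tail_pos:
  assumes "x > 0" "\<And>a. a \<in> set as \<Longrightarrow> a \<ge> 0"
  shows "cf_tail as x > 0"
  using assms(2) by (induction as) (auto simp: assms(1) intro!: add_nonneg_pos)

text \<open>Cutting the expansion at any place and closing the rest of the current block by x gives
  the complete quotients. The entry \<open>y\<close> recurs in every period, which makes q_j q_{j+1}
  unbounded even if other entries vanish.\<close>

lemma has_cf_value_periodic:
  assumes x: "x > 0" "cf_tail ys x = x"
    and nonneg: "\<And>a. a \<in> set (xs @ ys) \<Longrightarrow> a \<ge> 0"
    and a1: "cf_periodic xs ys 1 \<ge> 1"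
    and y: "y \<in> set ys" "y > 0"
  shows "has_cf_value (cf_periodic xs ys) (cf_tail xs x)"
proof -
  define s where "s = length ys"
  have s: "s > 0" using y by (auto simp: s_def)
  define X where "X i = (if i < length xs then cf_tail (drop i xs) x
     else cf_tail (drop ((i - length xs) mod s) ys) x)" for i
  have in_set: "cf_periodic xs ys i \<in> set (xs @ ys)" for i
    using s by (auto simp: cf_periodic_def s_def)
  have rec: "X i = of_int (cf_periodic xs ys i) + 1 / X (Suc i)" for i
  proof (cases "i < length xs")
    case True
    then have "X i = of_int (xs ! i) + 1 / cf_tail (drop (Suc i) xs) x"
      by (simp add: X_def Cons_nth_drop_Suc[symmetric])
    moreover have "X (Suc i) = cf_tail (drop (Suc i) xs) x"
      using True x by (cases "Suc i = length xs") (auto simp: X_def)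
    ultimately show ?thesis using True by (simp add: cf_periodic_def)
  next
    case False
    define r where "r = (i - length xs) mod s"
    have r: "r < length ys" using s by (simp add: r_def s_def)
    have "X i = of_int (ys ! r) + 1 / cf_tail (drop (Suc r) ys) x"
      using False r by (simp add: X_def Cons_nth_drop_Suc[symmetric] flip: r_def)
    moreover have "X (Suc i) = cf_tail (drop (Suc r) ys) x"
    proof -
      \<comment> \<open>At the end of a block, one side is \<open>cf_tail [] x\<close> and the other
        \<open>cf_tail ys x\<close>; the fixed point equation identifies them.\<close>
      have "Suc (i - length xs) mod s = (if Suc r = s then 0 else Suc r)"
        by (simp add: mod_Suc r_def)
      then show ?thesis using False x by (auto simp: X_def Suc_diff_le s_def)
    qed
    ultimately show ?thesis using False by (simp add: cf_periodic_def r_def s_def)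
  qed
  have pos: "X i > 0" for i
    unfolding X_def using nonneg by (auto intro!: cf_tail_pos x(1) dest: in_set_dropD)
  obtain r where r: "r < s" "ys ! r = y" using y by (auto simp: in_set_conv_nth s_def)
  have "cf_periodic xs ys (length xs + (r + s * j)) > 0" for j
    using r y by (simp add: cf_periodic_def flip: s_def)
  moreover have "length xs + (r + s * j) \<ge> j" for j
    using s by (simp add: trans_le_add2)
  ultimately have "\<exists>i\<ge>j. cf_periodic xs ys i > 0" for j by blast
  then have "has_cf_value (cf_periodic xs ys) (X 0)"
    by (intro has_cf_value_complete_quotients[OF rec pos nonneg[OF in_set] a1])
  moreover have "X 0 = cf_tail xs x" using x by (auto simp: X_def)
  ultimately show ?thesis by simp
qed

section \<open>The period of the theorem\<close>

text \<open>The powers of the matrix of x -> 1 + 1/x have Fibonacci entries. The entry f_{j-1} is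
  written f_{j+1} - f_j so that j = 0 is covered.\<close>

lemma cf_tail_ones:
  assumes "A > 0" "B > 0"
  shows "cf_tail (replicate j 1) (A / B)
    = (real (fib (Suc j)) * A + real (fib j) * B)
      / (real (fib j) * A + (real (fib (Suc j)) - real (fib j)) * B)"
proof (induction j)
  case (Suc j)
  define F G where "F = real (fib j)" "G = real (fib (Suc j))"
  note defs = this
  have "G > 0" "F \<ge> 0" by (auto simp: defs fib_neq_0_nat)
  then have "G * A + F * B > 0" using assms by (intro add_pos_nonneg) auto
  then show ?case using Suc by (simp add: field_simps flip: defs)
qed simp

lemma lucas_fib:
  "lucas (Suc (Suc j)) = 3 * int (fib (Suc j)) + int (fib j)"
  "lucas (Suc j) = int (fib (Suc j)) + 2 * int (fib j)"
  "lucas j = 2 * int (fib (Suc j)) - int (fib j)"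
  by (induction j) auto

text \<open>Multiplied by 5, this becomes L_{j+2} L_j - L_{j+1}^2 = 5 (-1)^j, the form of Cassini's
  identity for Lucas numbers.\<close>

lemma fib_Cassini_Suc:
  "int (fib (Suc j)) ^ 2 - int (fib (Suc j)) * int (fib j) - int (fib j) ^ 2 = (-1) ^ j"
  by (induction j) (auto simp: algebra_simps power2_eq_square)

text \<open>The block is evaluated from right to left in pieces, each value kept as a fraction of
  positive forms in x. With F = f_j and G = f_{j+1} the claim becomes a polynomial identity modulo
  \<open>quad\<close>.\<close>

lemma mu_block_fixed_point:
  fixes x :: real and k j :: nat
  defines "m \<equiv> 5 * real k + 3"
  assumes x: "x > 0"
    and quad: "of_int (lucas (j + 2)) * (x ^ 2 - 2 * m * x)
      = 2 * m * of_int (lucas (j + 1)) + of_int (lucas j)"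
  shows "cf_tail (mu_block (j + 2) k) x = x"
proof -
  define F G where "F = real (fib j)" "G = real (fib (Suc j))"
  note defs = this
  define K where "K = real k"
  have G: "G > 0" and F: "F \<ge> 0" and GF: "G \<ge> F" and K: "K \<ge> 0"
    by (auto simp: defs fib_neq_0_nat fib_mono K_def)
  have q: "(3 * G + F) * (x ^ 2 - 2 * m * x) = 2 * m * (G + 2 * F) + (2 * G - F)"
    using quad by (simp add: lucas_fib defs)
  define A B where "A = G * x + F" "B = F * x + (G - F)"
  note AB = this
  have A: "A > 0" using G F x by (simp add: AB add_pos_nonneg)
  have B: "B > 0"
  proof (cases "F = 0")
    case False
    then show ?thesis using F GF x by (simp add: AB add_pos_nonneg)
  qed (use G in \<open>simp add: AB\<close>)
  \<comment> \<open>The coefficients form the symmetric matrix of the palindrome 2, 1, 2k, 1,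
    2.\<close>
  define C D where "C = (18 * K + 12) * A + (6 * K + 5) * B" "D = (6 * K + 5) * A + (2 * K + 2) * B"
  note CD = this
  have C: "C > 0" and D: "D > 0" using A B K by (simp_all add: CD add_pos_pos)
  have t1: "cf_tail (replicate j 1) x = A / B"
    using cf_tail_ones[of x 1 j] x by (simp add: AB defs)
  have t2: "cf_tail [2, 1, 2 * int k, 1, 2] (A / B) = C / D"
  proof -
    have "cf_tail [2] (A / B) = (2 * A + B) / A" using A B by (simp add: field_simps)
    then have "cf_tail [1, 2] (A / B) = (3 * A + B) / (2 * A + B)"
      using A B by (simp add: field_simps)
    then have "cf_tail [2 * int k, 1, 2] (A / B)
        = (2 * K * (3 * A + B) + (2 * A + B)) / (3 * A + B)"
      using A B by (simp add: field_simps K_def)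
    moreover have "2 * K * (3 * A + B) + (2 * A + B) > 0"
      using A B K by (intro add_nonneg_pos) auto
    ultimately have "cf_tail [1, 2 * int k, 1, 2] (A / B)
        = (2 * K * (3 * A + B) + (2 * A + B) + (3 * A + B)) / (2 * K * (3 * A + B) + (2 * A + B))"
      using A B by (simp add: field_simps)
    also have "\<dots> = D / (2 * K * (3 * A + B) + (2 * A + B))"
      by (simp add: CD algebra_simps)
    finally have "cf_tail [2, 1, 2 * int k, 1, 2] (A / B)
        = 2 + (2 * K * (3 * A + B) + (2 * A + B)) / D" by simp
    also have "\<dots> = C / D"
      using D by (simp add: field_simps) (simp add: CD algebra_simps)
    finally show ?thesis .
  qed
  have t3: "cf_tail (replicate j 1) (C / D) = (G * C + F * D) / (F * C + (G - F) * D)"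
    using cf_tail_ones[OF C D, of j] by (simp add: defs)
  have E: "G * C + F * D > 0" using G F C D by (simp add: add_pos_nonneg)
  have "cf_tail (mu_block (j + 2) k) x = 2 * m + (F * C + (G - F) * D) / (G * C + F * D)"
    using t1 t2 t3 by (simp add: mu_block_def cf_tail_append m_def)
  also have "\<dots> = x"
  proof -
    let ?E = "G * C + F * D" and ?H = "F * C + (G - F) * D"
    \<comment> \<open>The x^2 coefficient on the left is divisible by L_n = 3G + F, and the first
      factor on the right is the cofactor; it equals 2/5 (m L_n + L_{n-1}). The constant terms match
      because m = 5K + 3.\<close>
    have "(x - 2 * m) * ?E - ?H
      = (2 * K * (3 * G + F) + 2 * (2 * G + F))
        * ((3 * G + F) * (x ^ 2 - 2 * m * x) - (2 * m * (G + 2 * F) + (2 * G - F)))"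
      by (simp add: CD AB m_def flip: K_def) algebra
    then have "(x - 2 * m) * ?E = ?H" using q by simp
    then have "?H / ?E = x - 2 * m" using E by (metis less_irrefl nonzero_mult_div_cancel_right)
    then show ?thesis by simp
  qed
  finally show ?thesis .
qed

text \<open>The larger root of the quadratic equation is written down first and then verified to be
  a positive fixed point of the block.\<close>

lemma has_cf_value_mu_block:
  fixes k j :: nat
  defines "m \<equiv> 5 * real k + 3"
  defines "L \<equiv> real_of_int (lucas (j + 2))" and "L' \<equiv> real_of_int (lucas (j + 1))"
  shows "has_cf_value (cf_periodic [] (mu_block (j + 2) k))
    (m + sqrt ((m * L + L') ^ 2 + 5 * (-1) ^ j) / L)"
proof -
  define F G where "F = real (fib j)" "G = real (fib (Suc j))"
  note defs = this
  have G: "G \<ge> 1" and F: "F \<ge> 0"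
    using fib_neq_0_nat[of "Suc j"] by (auto simp: defs simp del: fib.simps)
  have L: "L = 3 * G + F" "L' = G + 2 * F" "real_of_int (lucas j) = 2 * G - F"
    by (simp_all add: L_def L'_def lucas_fib defs)
  have m: "m \<ge> 3" by (simp add: m_def)
  have cassini: "G ^ 2 - G * F - F ^ 2 = (-1) ^ j"
    using arg_cong[OF fib_Cassini_Suc[of j], of real_of_int] by (simp add: defs)
  define S where "S = (m * L + L') ^ 2 + 5 * (-1) ^ j"
  \<comment> \<open>This gives m L + L' >= 10, so the radicand stays nonnegative also for odd
    \<open>j\<close>.\<close>
  have "m * L \<ge> 3 * 3" using m G F L by (intro mult_mono) auto
  then have "(m * L + L') ^ 2 \<ge> 10 ^ 2" using L G F by (intro power_mono) auto
  moreover have "(-1::real) ^ j \<ge> -1" by (cases "even j") auto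
  ultimately have S: "S \<ge> 0" by (simp add: S_def)
  define x where "x = m + sqrt S / L"
  have Lpos: "L > 0" using L G F by simp
  have x: "x > 0" using m S Lpos by (simp add: x_def add_pos_nonneg)
  have "(L * (x - m)) ^ 2 = S" using Lpos S by (simp add: x_def)
  then have "L * (L * (x ^ 2 - 2 * m * x)) = L * (2 * m * L' + (2 * G - F))"
    unfolding S_def L cassini[symmetric] by algebra
  then have "L * (x ^ 2 - 2 * m * x) = 2 * m * L' + (2 * G - F)"
    using Lpos by simp
  then have "cf_tail (mu_block (j + 2) k) x = x"
    using x by (intro mu_block_fixed_point) (simp_all add: m_def L_def L'_def lucas_fib defs)
  \<comment> \<open>The entry at index 1 is 2 if \<open>j = 0\<close>, where the strings of ones are
    empty, and 1 otherwise.\<close>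
  moreover have "cf_periodic [] (mu_block (j + 2) k) 1 \<ge> 1"
    by (cases j) (auto simp: cf_periodic_def mu_block_def nth_append)
  ultimately have "has_cf_value (cf_periodic [] (mu_block (j + 2) k)) (cf_tail [] x)"
    using x by (intro has_cf_value_periodic[of _ _ _ 2]) (auto simp: mu_block_def)
  then show ?thesis by (simp add: x_def S_def)
qed

section \<open>The expansions of square roots\<close>

text \<open>For w = sqrt (N^2 + 5) - N one has w (2N + w) = 5. Hence 1/w = b + w/5 and 5/w = 2N + w,
  which closes the period.\<close>

lemma has_cf_value_sqrt_plus_5:
  fixes N b c :: int
  assumes "b > 0" "2 * N = 5 * b" "c \<ge> 0"
  shows "has_cf_value (cf_periodic [c + N] [b, 2 * N]) (of_int c + sqrt (of_int N ^ 2 + 5))"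
proof -
  define M w where "M = real_of_int N" and "w = sqrt (M ^ 2 + 5) - M"
  have N: "N > 0" using assms by simp
  have "sqrt (M ^ 2 + 5) > sqrt (M ^ 2)" by (intro real_sqrt_less_mono) simp
  then have w: "w > 0" using N by (simp add: w_def M_def)
  have "(w + M) ^ 2 = M ^ 2 + 5" by (simp add: w_def add_nonneg_pos)
  then have q: "w * (2 * M + w) = 5" by algebra
  have "2 * M = 5 * of_int b" using assms(2) unfolding M_def by (metis of_int_mult of_int_numeral)
  moreover have "1 / (2 * M + w) = w / 5"
    using q w N by (simp add: M_def field_simps)
  moreover have "1 / w = (2 * M + w) / 5"
    using q w N by (simp add: field_simps)
  ultimately have "cf_tail [b, 2 * N] (1 / w) = 1 / w"
    by (simp add: M_def field_simps)
  then have "has_cf_value (cf_periodic [c + N] [b, 2 * N]) (cf_tail [c + N] (1 / w))"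
    using w assms N by (intro has_cf_value_periodic[of _ _ _ b]) (auto simp: cf_periodic_def)
  then show ?thesis by (simp add: w_def M_def)
qed

text \<open>For v = N - sqrt (N^2 - 5) one has v (2N - v) = 5, so 1/v = b - v/5 and 5/v = 2N - v.
  Each minus sign costs an extra entry 1, by a - 1/y = (a - 1) + 1 / (1 + 1 / (y - 1)).\<close>

lemma has_cf_value_sqrt_minus_5:
  fixes N b c :: int
  assumes "b \<ge> 2" "2 * N = 5 * b" "c \<ge> 0"
  shows "has_cf_value (cf_periodic [c + N - 1] [1, b - 2, 1, 2 * N - 2])
    (of_int c + sqrt (of_int N ^ 2 - 5))"
proof -
  define M v where "M = real_of_int N" and "v = M - sqrt (M ^ 2 - 5)"
  have N: "M \<ge> 5" using assms by (simp add: M_def)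
  then have M5: "M ^ 2 \<ge> 5 ^ 2" by (intro power_mono) auto
  have "sqrt (M ^ 2 - 5) < sqrt (M ^ 2)" by (intro real_sqrt_less_mono) simp
  then have v0: "v > 0" using N by (simp add: v_def)
  \<comment> \<open>So the integer part of the root is N - 1, which explains the first
    entry.\<close>
  have "(M - 1) ^ 2 < M ^ 2 - 5" using N by (simp add: power2_eq_square algebra_simps)
  then have "sqrt ((M - 1) ^ 2) < sqrt (M ^ 2 - 5)" by (rule real_sqrt_less_mono)
  then have v1: "v < 1" using N by (simp add: v_def)
  have "(M - v) ^ 2 = M ^ 2 - 5" using M5 by (simp add: v_def)
  then have q: "v * (2 * M - v) = 5" by algebra
  have b: "real_of_int b = 2 * M / 5"
    using assms(2) unfolding M_def by (metis of_int_mult of_int_numeral nonzero_mult_div_cancel_left zero_neq_numeral)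
  have e1: "cf_tail [2 * N - 2] (1 / (1 - v)) = 2 * M - v - 1" by (simp add: M_def)
  have e2: "cf_tail [1, 2 * N - 2] (1 / (1 - v)) = (2 * M - v) / (2 * M - v - 1)"
    using e1 N v1 by (simp add: field_simps)
  have e3: "cf_tail [b - 2, 1, 2 * N - 2] (1 / (1 - v)) = (1 - v) / v"
  proof -
    have "1 / cf_tail [1, 2 * N - 2] (1 / (1 - v)) = 1 - 1 / (2 * M - v)"
      unfolding e2 using N v1 by (simp add: field_simps)
    also have "1 / (2 * M - v) = v / 5" using q N v1 by (simp add: field_simps)
    finally have "cf_tail [b - 2, 1, 2 * N - 2] (1 / (1 - v)) = (2 * M - v) / 5 - 1"
      using b by (simp add: field_simps)
    also have "(2 * M - v) / 5 = 1 / v" using q v0 by (simp add: field_simps)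
    finally show ?thesis using v0 by (simp add: field_simps)
  qed
  have "cf_tail [1, b - 2, 1, 2 * N - 2] (1 / (1 - v)) = 1 / (1 - v)"
    unfolding cf_tail.simps(2)[of 1] e3 using v0 v1 by (simp add: field_simps)
  then have "has_cf_value (cf_periodic [c + N - 1] [1, b - 2, 1, 2 * N - 2])
      (cf_tail [c + N - 1] (1 / (1 - v)))"
    using v1 assms by (intro has_cf_value_periodic[of _ _ _ 1]) (auto simp: cf_periodic_def)
  then show ?thesis by (simp add: v_def M_def)
qed

section \<open>Integrality and assembly of the results\<close>

lemma algebraic_int_of_int_add_sqrt:
  assumes "d \<ge> 0"
  shows "algebraic_int (of_int c + sqrt (of_int d))"
proof (rule algebraic_int.intros)
  \<comment> \<open>This is (X - c)^2 - d.\<close>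
  let ?p = "[:of_int (c ^ 2 - d), of_int (- 2 * c), 1:] :: real poly"
  show "lead_coeff ?p = 1" by simp
  show "\<forall>i. coeff ?p i \<in> \<int>"
    by (auto simp: coeff_pCons split: nat.splits)
  show "poly ?p (of_int c + sqrt (of_int d)) = 0"
    using assms by (simp add: algebra_simps power2_eq_square)
qed

text \<open>Convergence is asserted because \<open>cf_value\<close> is unspecified without it, and
  divisibility by 5 because it makes the \<open>div 5\<close> in the entries exact.\<close>

theorem theorem5:
  fixes n k :: nat
  assumes "n \<ge> 2"
  shows "convergent (cf_convergent (cf_periodic [] (mu_block n k)))
    \<and> algebraic_int (mu n k)
    \<and> 5 dvd 2 * lucas_like (n + 1) (5 * int k + 3)
    \<and> (odd n \<longrightarrow>
         has_cf_value
           (cf_periodic [lucas_like (n + 1) (10 * int k + 6) - 1]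
              [1, 2 * lucas_like (n + 1) (5 * int k + 3) div 5 - 2,
               1, 2 * lucas_like (n + 1) (5 * int k + 3) - 2])
           (mu n k))
    \<and> (even n \<longrightarrow>
         has_cf_value
           (cf_periodic [lucas_like (n + 1) (10 * int k + 6)]
              [2 * lucas_like (n + 1) (5 * int k + 3) div 5,
               2 * lucas_like (n + 1) (5 * int k + 3)])
           (mu n k))"
proof -
  obtain j where n: "n = j + 2" using assms by (metis add.commute le_Suc_ex)
  define F G where "F = int (fib j)" "G = int (fib (Suc j))"
  note defs = this
  have G: "G \<ge> 1" and F: "F \<ge> 0"
    using fib_neq_0_nat[of "Suc j"] by (auto simp: defs simp del: fib.simps)
  define m L L' N c b where "m = 5 * int k + 3" "L = 3 * G + F" "L' = G + 2 * F"
    "N = m * L + L'" "c = m * L" "b = 2 * N div 5"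
  note mdefs = this
  have parity: "even n \<longleftrightarrow> even j" by (simp add: n)
  have lucas: "lucas (j + 2) = L" "lucas (j + 1) = L'"
    by (simp_all add: mdefs lucas_fib defs)
  have "lucas_like (n + 1) r = r * L + L'" for r
    using lucas by (simp add: lucas_like_def n del: lucas.simps)
  \<comment> \<open>As 10k + 6 = 2m, the second value is 2 m L + L', that is N shifted by the
    integer c = m L.\<close>
  then have like: "lucas_like (n + 1) (5 * int k + 3) = N" "lucas_like (n + 1) (10 * int k + 6) = c + N"
    by (simp_all add: mdefs algebra_simps)
  \<comment> \<open>The factor 5 comes from m = 5k + 3 and 3 L + L' = 5 (2G + F).\<close>
  have "2 * N = 5 * (2 * (k * L + 2 * G + F))" by (simp add: mdefs algebra_simps)
  then have Nb: "2 * N = 5 * b" and b_eq: "b = 2 * (k * L + 2 * G + F)"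
    by (simp_all add: mdefs(6))
  have "int k * L \<ge> 0" using G F by (simp add: mdefs)
  then have b: "b \<ge> 2" using b_eq G F by simp
  have c: "c \<ge> 0" using G F by (simp add: mdefs)
  have val: "has_cf_value (cf_periodic [] (mu_block n k))
      (of_int m + sqrt (of_int N ^ 2 + 5 * (-1) ^ j) / of_int L)"
    using has_cf_value_mu_block[of j k] unfolding n lucas by (simp add: mdefs)
  have mu: "mu n k = of_int c + sqrt (of_int N ^ 2 + 5 * (-1) ^ j)"
  proof -
    have "cf_value (cf_periodic [] (mu_block n k))
      = of_int m + sqrt (of_int N ^ 2 + 5 * (-1) ^ j) / of_int L"
      using val by (simp add: cf_value_def has_cf_value_def limI)
    moreover have "L > 0" using G F by (simp add: mdefs)
    ultimately show ?thesis using lucas by (simp add: mu_def n field_simps mdefs(5))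
  qed
  have "convergent (cf_convergent (cf_periodic [] (mu_block n k)))"
    using val by (auto simp: has_cf_value_def convergent_def)
  moreover have "algebraic_int (mu n k)"
  proof -
    have "N ^ 2 \<ge> 5 ^ 2" using Nb b by (intro power_mono) auto
    moreover have "(-1::int) ^ j \<ge> -1" by (cases "even j") auto
    ultimately have "N ^ 2 + 5 * (-1) ^ j \<ge> 0" by simp
    from algebraic_int_of_int_add_sqrt[OF this, of c] show ?thesis by (simp add: mu)
  qed
  moreover have "5 dvd 2 * N" using Nb by simp
  moreover have "has_cf_value (cf_periodic [c + N - 1] [1, b - 2, 1, 2 * N - 2]) (mu n k)" if "odd n"
    using has_cf_value_sqrt_minus_5[OF b Nb c] that by (simp add: mu parity)
  moreover have "has_cf_value (cf_periodic [c + N] [b, 2 * N]) (mu n k)" if "even n"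
    using has_cf_value_sqrt_plus_5[OF _ Nb c] b that by (simp add: mu parity)
  ultimately show ?thesis unfolding like mdefs(6)[symmetric] by blast
qed

end
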